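(* There exists a polynomial-time algorithm that takes as input a permutation DAG $G$ and a topological ordering $\gamma$ of $G$, detects whether $\alpha(G,\gamma)$ is finite, and if so returns a sequence achieving $\alpha(G,\gamma)$.
   Context: For a sequence $\sigma=(\sigma(1),\ldots,\sigma(n))$ of natural numbers, $\mathsf{PermDAG}(\sigma)$ is the directed graph with vertex set $\{t_1,\ldots,t_n\}$ and an arc $(t_j,t_i)$ for every $i,j\in[n]$ with $i<j$ and $\sigma(i)\le\sigma(j)$. A directed graph $G$ is a permutation DAG if it is isomorphic to $\mathsf{PermDAG}(\tau)$ for some sequence $\tau$. A topological ordering of an $n$-vertex DAG $G=(V,A)$ is a bijection $\gamma:V\to[n]$ such that every arc $(v,u)\in A$ has $\gamma(u)<\gamma(v)$. The $\gamma$-alphabet size $\alpha(G,\gamma)$ is the minimum $k$ such that there exists $\tau\in[k]^n$ for which $\mathsf{PermDAG}(\tau)=(\{t_1,\ldots,t_n\},A')$ is isomorphic to $G$ under the mapping $\phi(t_i)=\gamma^{-1}(i)$ for all $i\in[n]$ (i.e. $(t_j,t_i)\in A'$ iff $(\phi(t_j),\phi(t_i))\in A$); $\alpha(G,\gamma)=\infty$ if no such $\tau$ exists. A sequence achieving $\alpha(G,\gamma)$ is such a $\tau$ with $k=\alpha(G,\gamma)$. *)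

theory Defs
  imports
    "Graph_Theory.Pair_Digraph"
    "Graph_Theory.Digraph_Isomorphism"
    "HOL-Library.Extended_Nat"
    "HOL-Computational_Algebra.Polynomial"
begin

section \<open>Permutation DAGs and the alphabet size of a topological ordering\<close>

text \<open>
  A sequence \<open>\<sigma> = (\<sigma>(1), \<dots>, \<sigma>(n))\<close> is a list, so \<open>\<sigma>(i)\<close> is \<open>\<sigma> ! (i - 1)\<close>; the vertex
  \<open>t\<^sub>i\<close> is the number \<open>i\<close>.
\<close>

definition PermDAG :: "nat list \<Rightarrow> nat pair_pre_digraph" where
  "PermDAG \<sigma> = \<lparr> pverts = {1..length \<sigma>},
     parcs = {(j, i). i \<in> {1..length \<sigma>} \<and> j \<in> {1..length \<sigma>} \<and>
                      i < j \<and> \<sigma> ! (i - 1) \<le> \<sigma> ! (j - 1)} \<rparr>"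

definition permutation_DAG :: "'v pair_pre_digraph \<Rightarrow> bool" where
  "permutation_DAG G \<longleftrightarrow> (\<exists>\<tau>. digraph_iso (with_proj (PermDAG \<tau>)) (with_proj G))"

definition topological_ordering :: "'v pair_pre_digraph \<Rightarrow> ('v \<Rightarrow> nat) \<Rightarrow> bool" where
  "topological_ordering G \<gamma> \<longleftrightarrow>
     bij_betw \<gamma> (pverts G) {1..card (pverts G)} \<and>
     (\<forall>(v, u) \<in> parcs G. \<gamma> u < \<gamma> v)"

definition represents :: "'v pair_pre_digraph \<Rightarrow> ('v \<Rightarrow> nat) \<Rightarrow> nat \<Rightarrow> nat list \<Rightarrow> bool" where
  "represents G \<gamma> k \<tau> \<longleftrightarrow>
     length \<tau> = card (pverts G) \<and> set \<tau> \<subseteq> {1..k} \<and>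
     (let \<phi> = inv_into (pverts G) \<gamma> in
       \<forall>i \<in> {1..card (pverts G)}. \<forall>j \<in> {1..card (pverts G)}.
         (j, i) \<in> parcs (PermDAG \<tau>) \<longleftrightarrow> (\<phi> j, \<phi> i) \<in> parcs G)"

text \<open>The infimum of the empty set in \<^typ>\<open>enat\<close> is \<open>\<infinity>\<close>.\<close>

definition alphabet_size :: "'v pair_pre_digraph \<Rightarrow> ('v \<Rightarrow> nat) \<Rightarrow> enat" where
  "alphabet_size G \<gamma> = Inf {enat k | k. \<exists>\<tau>. represents G \<gamma> k \<tau>}"

definition achieves_alphabet_size ::
    "'v pair_pre_digraph \<Rightarrow> ('v \<Rightarrow> nat) \<Rightarrow> nat list \<Rightarrow> bool" where
  "achieves_alphabet_size G \<gamma> \<tau> \<longleftrightarrow>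
     (\<exists>k. alphabet_size G \<gamma> = enat k \<and> represents G \<gamma> k \<tau>)"


section \<open>Random access machine programs and their running time\<close>

text \<open>
  Structured programs for a random access machine with unit-cost instructions. A state consists of
  registers and an indirectly addressable memory, all holding natural numbers. The only arithmetic
  instructions are addition and truncated subtraction. Hence, apart from the fixed constants of the
  program, the maximal bit length in a state grows by at most one per step, and this model is polynomially equivalent to Turing machines
  (multiplication at unit cost would break this).
\<close>

type_synonym ram_state = "(nat \<Rightarrow> nat) \<times> (nat \<Rightarrow> nat)"

datatype ram_prog =
    Skip
  | Const nat nat
  | Move nat nat
  | Add nat nat nat
  | Sub nat nat nat
  | Load nat nat
  | Store nat nat
  | Seq ram_prog ram_prog
  | If nat ram_prog ram_prog
  | While nat ram_prog

text \<open>\<open>exec p s t s'\<close>: started in state \<open>s\<close>, program \<open>p\<close> halts after exactly \<open>t\<close> steps in \<open>s'\<close>.\<close>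

inductive exec :: "ram_prog \<Rightarrow> ram_state \<Rightarrow> nat \<Rightarrow> ram_state \<Rightarrow> bool" where
  Skip: "exec Skip s 1 s"
| Const: "exec (Const x c) (r, m) 1 (r(x := c), m)"
| Move: "exec (Move x y) (r, m) 1 (r(x := r y), m)"
| Add: "exec (Add x y z) (r, m) 1 (r(x := r y + r z), m)"
| Sub: "exec (Sub x y z) (r, m) 1 (r(x := r y - r z), m)"
| Load: "exec (Load x y) (r, m) 1 (r(x := m (r y)), m)"
| Store: "exec (Store x y) (r, m) 1 (r, m(r x := r y))"
| Seq: "exec p s t s' \<Longrightarrow> exec q s' t' s'' \<Longrightarrow> exec (Seq p q) s (t + t') s''"
| If_True: "r x \<noteq> 0 \<Longrightarrow> exec p (r, m) t s' \<Longrightarrow> exec (If x p q) (r, m) (Suc t) s'"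
| If_False: "r x = 0 \<Longrightarrow> exec q (r, m) t s' \<Longrightarrow> exec (If x p q) (r, m) (Suc t) s'"
| While_True: "r x \<noteq> 0 \<Longrightarrow> exec p (r, m) t s' \<Longrightarrow> exec (While x p) s' t' s'' \<Longrightarrow>
    exec (While x p) (r, m) (Suc (t + t')) s''"
| While_False: "r x = 0 \<Longrightarrow> exec (While x p) (r, m) 1 (r, m)"

inductive_cases exec_elims:
  "exec Skip s t s'"
  "exec (Const x c) s t s'"
  "exec (Move x y) s t s'"
  "exec (Add x y z) s t s'"
  "exec (Sub x y z) s t s'"
  "exec (Load x y) s t s'"
  "exec (Store x y) s t s'"
  "exec (Seq p q) s t s'"
  "exec (If x p q) s t s'"
  "exec (While x p) s t s'"

lemma exec_deterministic:
  "exec p s t1 s1 \<Longrightarrow> exec p s t2 s2 \<Longrightarrow> t1 = t2 \<and> s1 = s2"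
proof (induction arbitrary: t2 s2 rule: exec.induct)
  case (Seq p s t s' q t' s'')
  from Seq.prems show ?case
    by (rule exec_elims(8)) (use Seq.IH in metis)
next
  case (If_True r x p m t s' q)
  from If_True.prems show ?case
    by (rule exec_elims(9)) (use If_True.hyps If_True.IH in \<open>metis prod.inject neq0_conv\<close>)+
next
  case (If_False r x q m t s' p)
  from If_False.prems show ?case
    by (rule exec_elims(9)) (use If_False.hyps If_False.IH in \<open>metis prod.inject neq0_conv\<close>)+
next
  case (While_True r x p m t s' t' s'')
  from While_True.prems show ?case
    by (rule exec_elims(10)) (use While_True.hyps While_True.IH in \<open>metis prod.inject neq0_conv\<close>)+
next
  case (While_False r x p m)
  from While_False.prems show ?case
    by (rule exec_elims(10)) (use While_False.hyps in simp_all)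
next
  case Skip then show ?case by (rule exec_elims(1)) simp
next
  case Const then show ?case by (rule exec_elims(2)) simp
next
  case Move then show ?case by (rule exec_elims(3)) simp
next
  case Add then show ?case by (rule exec_elims(4)) simp
next
  case Sub then show ?case by (rule exec_elims(5)) simp
next
  case Load then show ?case by (rule exec_elims(6)) simp
next
  case Store then show ?case by (rule exec_elims(7)) simp
qed

text \<open>
  The input and the output are lists of numbers in the memory cells \<open>0, 1, \<dots>\<close>, with their length
  in register \<open>0\<close>.
\<close>

definition initial_state :: "nat list \<Rightarrow> ram_state" where
  "initial_state xs =
     ((\<lambda>x. if x = 0 then length xs else 0), (\<lambda>a. if a < length xs then xs ! a else 0))"

definition output_of :: "ram_state \<Rightarrow> nat list" where
  "output_of s = map (snd s) [0..<fst s 0]"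

definition computes_in :: "ram_prog \<Rightarrow> nat list \<Rightarrow> nat \<Rightarrow> nat list \<Rightarrow> bool" where
  "computes_in p xs t ys \<longleftrightarrow> (\<exists>s. exec p (initial_state xs) t s \<and> output_of s = ys)"

text \<open>
  The instance \<open>(G, \<gamma>)\<close>, with the vertices of \<open>G\<close> listed as \<open>vs\<close>, is given by the number of vertices
  \<open>n\<close>, the \<open>n \<times> n\<close> adjacency matrix row by row, and the values of \<open>\<gamma>\<close>. For a topological ordering
  these \<open>1 + n\<^sup>2 + n\<close> numbers are at most \<open>max 1 n\<close>, so the length of this list and the bit length
  of the instance bound each other polynomially.
\<close>

definition encode_instance :: "'v list \<Rightarrow> 'v pair_pre_digraph \<Rightarrow> ('v \<Rightarrow> nat) \<Rightarrow> nat list" where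
  "encode_instance vs G \<gamma> =
     length vs #
     concat (map (\<lambda>v. map (\<lambda>u. if (v, u) \<in> parcs G then 1 else 0) vs) vs) @
     map \<gamma> vs"

end

theory Submission
  imports Defs
begin

text \<open>
  For \<open>\<gamma> u < \<gamma> v\<close>, a representing sequence must give \<open>u\<close> at most the value of \<open>v\<close> if \<open>(v, u)\<close> is an arc,
  and a strictly larger value otherwise. This is a system of difference constraints, whose pointwise
  least solution uses the smallest alphabet. Starting from the zero sequence, every violated
  constraint is repaired by increasing by one the value that is too small; the values never exceed
  those of any solution. If a solution exists, then replacing values by their ranks gives one with
  values below \<open>n\<close>, so there are at most \<open>n\<^sup>2\<close> repairs. Hence, if each of more than \<open>n\<^sup>2\<close> sweeps over
  all constraints makes a repair, then no solution exists.
\<close>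

section \<open>Difference constraints\<close>

definition violated :: "(nat \<Rightarrow> nat) \<Rightarrow> (nat \<Rightarrow> nat \<Rightarrow> bool) \<Rightarrow> (nat \<Rightarrow> nat) \<Rightarrow> nat \<Rightarrow> nat \<Rightarrow> bool" where
  "violated g E h b a \<longleftrightarrow> g a < g b \<and> (if E b a then h b < h a else h a \<le> h b)"

definition valid :: "nat \<Rightarrow> (nat \<Rightarrow> nat) \<Rightarrow> (nat \<Rightarrow> nat \<Rightarrow> bool) \<Rightarrow> (nat \<Rightarrow> nat) \<Rightarrow> bool" where
  "valid n g E h \<longleftrightarrow> (\<forall>b<n. \<forall>a<n. \<not> violated g E h b a)"

text \<open>Together with \<open>valid\<close> this singles out the pointwise least solution. If
  there is no solution it holds vacuously, so it can serve as an invariant before feasibility is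
  known.\<close>

definition below_valid :: "nat \<Rightarrow> (nat \<Rightarrow> nat) \<Rightarrow> (nat \<Rightarrow> nat \<Rightarrow> bool) \<Rightarrow> (nat \<Rightarrow> nat) \<Rightarrow> bool" where
  "below_valid n g E h \<longleftrightarrow> (\<forall>f. valid n g E f \<longrightarrow> (\<forall>x<n. h x \<le> f x))"

definition relax :: "(nat \<Rightarrow> nat \<Rightarrow> bool) \<Rightarrow> (nat \<Rightarrow> nat) \<Rightarrow> nat \<Rightarrow> nat \<Rightarrow> (nat \<Rightarrow> nat)" where
  "relax E h b a = (if E b a then h(b := Suc (h b)) else h(a := Suc (h a)))"

text \<open>Any solution \<open>f\<close> satisfies the constraint that \<open>h\<close> violates.
  For an arc, \<open>h b < h a <= f a <= f b\<close>; otherwise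
  \<open>h a <= h b <= f b < f a\<close>. Either way there is room to increase the smaller side by
  one.\<close>

lemma below_valid_relax:
  assumes "below_valid n g E h" "violated g E h b a" "b < n" "a < n"
  shows "below_valid n g E (relax E h b a)"
  unfolding below_valid_def
proof (intro allI impI)
  fix f x assume f: "valid n g E f" and x: "x < n"
  have le: "h y \<le> f y" if "y < n" for y
    using assms(1) f that by (auto simp: below_valid_def)
  have "\<not> violated g E f b a"
    using f assms(3,4) by (auto simp: valid_def)
  then show "relax E h b a x \<le> f x"
    using assms(2) le[OF x] le[OF assms(3)] le[OF assms(4)]
    by (auto simp: relax_def violated_def split: if_splits)
qed

lemma sum_fun_upd_Suc:
  fixes h :: "nat \<Rightarrow> nat"
  assumes "b < n"
  shows "sum (h(b := Suc (h b))) {..<n} = Suc (sum h {..<n})"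
proof -
  have "sum (h(b := Suc (h b))) {..<n} = (\<Sum>x<n. h x + (if x = b then 1 else 0))"
    by (rule sum.cong) auto
  then show ?thesis
    using assms by (simp add: sum.distrib)
qed

lemma sum_relax: "b < n \<Longrightarrow> a < n \<Longrightarrow> sum (relax E h b a) {..<n} = Suc (sum h {..<n})"
  by (cases "E b a") (simp_all only: relax_def if_True if_False sum_fun_upd_Suc)

lemma valid_imp_valid_less:
  assumes "valid n g E f"
  shows "\<exists>f'. valid n g E f' \<and> (\<forall>x<n. f' x < n)"
proof -
  \<comment> \<open>The rank of \<open>f x\<close> among the attained values. Constraints only
    compare two values, so ranks satisfy them too, and there are at most \<open>n\<close> distinct
    values.\<close>
  define f' where "f' x = card {y \<in> f ` {..<n}. y < f x}" for x
  have mono: "f' x \<le> f' y" if "f x \<le> f y" for x y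
    unfolding f'_def using that by (intro card_mono) auto
  have strict: "f' x < f' y" if "f x < f y" "x < n" for x y
    unfolding f'_def using that by (intro psubset_card_mono) auto
  have "f' x < n" if "x < n" for x
  proof -
    have "f' x < card (f ` {..<n})"
      unfolding f'_def using that by (intro psubset_card_mono) auto
    also have "\<dots> \<le> n"
      using card_image_le[of "{..<n}" f] by simp
    finally show ?thesis .
  qed
  moreover have "valid n g E f'"
    using assms mono strict unfolding valid_def violated_def
    by (smt (verit) leD leI)
  ultimately show ?thesis by blast
qed

lemma not_valid_if_large_sum:
  assumes "below_valid n g E h" "n * n < sum h {..<n}"
  shows "\<not> valid n g E f"
proof
  assume "valid n g E f"
  then obtain f' where f': "valid n g E f'" "\<And>x. x < n \<Longrightarrow> f' x < n"
    using valid_imp_valid_less by blast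
  have "sum h {..<n} \<le> (\<Sum>x<n. n)"
    using assms(1) f' by (intro sum_mono) (fastforce simp: below_valid_def intro: less_imp_le le_trans)
  with assms(2) show False by simp
qed

section \<open>Weakest preconditions for random access machine programs\<close>

text \<open>Total correctness: the program must halt, and its step count is passed to the
  postcondition, so running time and result are proved together.\<close>

definition wp :: "ram_prog \<Rightarrow> ram_state \<Rightarrow> (nat \<Rightarrow> ram_state \<Rightarrow> bool) \<Rightarrow> bool" where
  "wp p s Q \<longleftrightarrow> (\<exists>t s'. exec p s t s' \<and> Q t s')"

lemma wp_basic [simp]:
  "wp Skip s Q \<longleftrightarrow> Q 1 s"
  "wp (Const x c) (r, m) Q \<longleftrightarrow> Q 1 (r(x := c), m)"
  "wp (Move x y) (r, m) Q \<longleftrightarrow> Q 1 (r(x := r y), m)"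
  "wp (Add x y z) (r, m) Q \<longleftrightarrow> Q 1 (r(x := r y + r z), m)"
  "wp (Sub x y z) (r, m) Q \<longleftrightarrow> Q 1 (r(x := r y - r z), m)"
  "wp (Load x y) (r, m) Q \<longleftrightarrow> Q 1 (r(x := m (r y)), m)"
  "wp (Store x y) (r, m) Q \<longleftrightarrow> Q 1 (r, m(r x := r y))"
  unfolding wp_def by (auto simp del: split_paired_Ex intro: exec.intros[unfolded One_nat_def] elim!: exec_elims(1-7))

lemma wp_Seq [simp]:
  "wp (Seq p q) s Q \<longleftrightarrow> wp p s (\<lambda>t s'. wp q s' (\<lambda>t' s''. Q (t + t') s''))"
  unfolding wp_def by (blast intro: exec.Seq elim: exec_elims)

lemma wp_If [simp]:
  "wp (If x p q) (r, m) Q \<longleftrightarrow>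
     (if r x \<noteq> 0 then wp p (r, m) (\<lambda>t. Q (Suc t)) else wp q (r, m) (\<lambda>t. Q (Suc t)))"
  unfolding wp_def by (auto intro: exec.intros elim!: exec_elims(9))

lemma wp_mono: "wp p s Q \<Longrightarrow> (\<And>t r m. Q t (r, m) \<Longrightarrow> Q' t (r, m)) \<Longrightarrow> wp p s Q'"
  unfolding wp_def by fast

text \<open>The index of \<open>I\<close> is the exact number of iterations left, hence also the
  termination measure. An iteration costs at most \<open>c\<close> for the body and one for the
  test; the final \<open>1\<close> is the failing test.\<close>

lemma wp_While:
  assumes "I k s"
    and nonzero: "\<And>k r m. I (Suc k) (r, m) \<Longrightarrow> r x \<noteq> 0"
    and zero: "\<And>r m. I 0 (r, m) \<Longrightarrow> r x = 0"
    and body: "\<And>k r m. I (Suc k) (r, m) \<Longrightarrow> wp p (r, m) (\<lambda>t s'. t \<le> c \<and> I k s')"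
  shows "wp (While x p) s (\<lambda>t s'. t \<le> k * Suc c + 1 \<and> I 0 s')"
  using assms(1)
proof (induction k arbitrary: s)
  case 0
  obtain r m where s: "s = (r, m)" by fastforce
  then show ?case
    using 0 zero[of r m] exec.While_False[of r x p m] unfolding wp_def by auto
next
  case (Suc k)
  obtain r m where s: "s = (r, m)" by fastforce
  obtain t s' where p: "exec p (r, m) t s'" "t \<le> c" "I k s'"
    using body Suc.prems s unfolding wp_def by blast
  obtain t' s'' where "exec (While x p) s' t' s''" "t' \<le> k * Suc c + 1" "I 0 s''"
    using Suc.IH[OF p(3)] unfolding wp_def by blast
  then show ?case
    using p exec.While_True[of r x p m t s' t' s''] nonzero[of k r m] Suc.prems s
    unfolding wp_def by (intro exI[of _ "Suc (t + t')"] exI[of _ s'']) auto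
qed

fun seqs :: "ram_prog list \<Rightarrow> ram_prog" where
  "seqs [] = Skip"
| "seqs (p # ps) = Seq p (seqs ps)"

section \<open>The program\<close>

text \<open>
  Registers: 1 holds the constant 1, 2 the number \<open>n\<close> of vertices, 3 the address of the values of
  \<open>\<gamma>\<close>, 4 the address of the tentative sequence, 5 the number of remaining sweeps, 6 and 8 the
  current pair of vertices, 7 the address of the current row of the adjacency matrix, and 9 is
  nonzero iff the current sweep has changed the tentative sequence. The tentative sequence lies
  behind the input, in cells that are initially 0; its values are therefore shifted by one with
  respect to the output.
\<close>

definition relax_prog :: ram_prog where
  "relax_prog = seqs
    [Sub 8 8 1,
     Add 10 3 8, Load 10 10, Add 11 3 6, Load 11 11, Sub 11 11 10,
     If 11
       (seqs
         [Add 10 4 8, Add 11 4 6, Load 12 10, Load 13 11, Add 14 7 8, Load 14 14,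
          If 14
            (seqs [Sub 14 12 13, Add 13 13 1, If 14 (seqs [Store 11 13, Const 9 1]) Skip])
            (seqs [Add 13 13 1, Sub 14 13 12, Add 12 12 1, If 14 (seqs [Store 10 12, Const 9 1]) Skip])])
       Skip]"

definition row_prog :: ram_prog where
  "row_prog = seqs [Sub 6 6 1, Sub 7 7 2, Move 8 2, While 8 relax_prog]"

definition sweep_prog :: ram_prog where
  "sweep_prog = seqs [Sub 5 5 1, Const 9 0, Move 6 2, Move 7 3, While 6 row_prog]"

definition write_prog :: ram_prog where
  "write_prog = seqs
    [Sub 8 8 1, Add 10 3 8, Load 10 10, Add 11 4 8, Load 11 11, Add 11 11 1, Store 10 11]"

definition output_prog :: ram_prog where
  "output_prog = seqs
    [Const 10 0,
     If 9
       (seqs [Store 10 10, Const 0 1])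
       (seqs [Move 8 2, While 8 write_prog, Const 10 0, Store 10 1, Add 0 2 1])]"

definition alphabet_prog :: ram_prog where
  "alphabet_prog = seqs
    [Const 1 1, Const 10 0, Load 2 10, Sub 3 0 2, Move 4 0, Move 5 0, While 5 sweep_prog, output_prog]"

section \<open>Invariants, correctness and running time of the program\<close>

definition stores :: "nat \<Rightarrow> (nat \<Rightarrow> nat) \<Rightarrow> (nat \<Rightarrow> nat \<Rightarrow> bool) \<Rightarrow> (nat \<Rightarrow> nat) \<Rightarrow> (nat \<Rightarrow> nat) \<Rightarrow> bool" where
  "stores n g E h m \<longleftrightarrow>
     m 0 = n \<and> (\<forall>b<n. \<forall>a<n. m (1 + b * n + a) = of_bool (E b a)) \<and>
     (\<forall>a<n. m (1 + n * n + a) = g a) \<and> (\<forall>a<n. m (1 + n * n + n + a) = h a)"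

text \<open>Separates the matrix cells from the blocks behind them in memory.\<close>

lemma mult_add_less_square:
  assumes "b < n" "a < (n :: nat)"
  shows "b * n + a < n * n"
proof -
  have "b * n + a < Suc b * n" using assms by simp
  also have "\<dots> \<le> n * n" using assms by (intro mult_le_mono1) simp
  finally show ?thesis .
qed

lemma stores_fun_upd:
  assumes "stores n g E h m" "b < n"
  shows "stores n g E (h(b := v)) (m(Suc (n * n + n + b) := v))"
proof -
  have "c * n + a \<noteq> n * n + n + b" if "c < n" "a < n" for a c
    using mult_add_less_square[OF that] by simp
  then show ?thesis
    using assms by (auto simp: stores_def)
qed

text \<open>The sum of the tentative sequence is the potential. \<open>S\<close> is what earlier
  sweeps guarantee, and the flag in register 9 adds one for the current sweep, however many repairs
  it makes. \<open>D\<close> collects the pairs already examined in this sweep; while the flag is 0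
  the sequence has not changed, so their checks are still current.\<close>

definition progress ::
    "nat \<Rightarrow> (nat \<Rightarrow> nat) \<Rightarrow> (nat \<Rightarrow> nat \<Rightarrow> bool) \<Rightarrow> nat \<Rightarrow> (nat \<times> nat) set \<Rightarrow> ram_state \<Rightarrow> bool" where
  "progress n g E S D = (\<lambda>(r, m). \<exists>h.
     stores n g E h m \<and> below_valid n g E h \<and> S + r 9 \<le> sum h {..<n} \<and>
     (r 9 = 0 \<longrightarrow> (\<forall>(b, a) \<in> D. \<not> violated g E h b a)) \<and>
     r 1 = 1 \<and> r 2 = n \<and> r 3 = 1 + n * n \<and> r 4 = 1 + n * n + n)"

lemma wp_relax_prog:
  assumes "progress n g E S D (r, m)" and r: "r 8 = Suc a" "r 6 = b" "r 7 = 1 + b * n"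
    and n: "a < n" "b < n"
  shows "wp relax_prog (r, m) (\<lambda>t (r', m'). t \<le> 25 \<and> progress n g E S (insert (b, a) D) (r', m') \<and>
    r' 8 = a \<and> r' 7 = r 7 \<and> r' 6 = r 6 \<and> r' 5 = r 5)"
proof -
  obtain h where h: "stores n g E h m" "below_valid n g E h" "S + r 9 \<le> sum h {..<n}"
    and D: "r 9 = 0 \<Longrightarrow> \<forall>(b, a) \<in> D. \<not> violated g E h b a"
    and regs: "r (Suc 0) = 1" "r 2 = n" "r 3 = 1 + n * n" "r 4 = 1 + n * n + n"
    using assms(1) by (auto simp: progress_def)
  have mem: "m (Suc (n * n + a)) = g a" "m (Suc (n * n + b)) = g b"
    "m (Suc (n * n + n + a)) = h a" "m (Suc (n * n + n + b)) = h b"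
    "m (Suc (b * n + a)) = of_bool (E b a)"
    using h(1) n by (auto simp: stores_def)
  have unchanged: "progress n g E S (insert (b, a) D) (r', m)"
    if "\<not> violated g E h b a" "r' 9 = r 9" "r' 1 = 1" "r' 2 = n" "r' 3 = Suc (n * n)" "r' 4 = Suc (n * n + n)"
    for r'
    unfolding progress_def using that h D by (auto intro!: exI[of _ h])
  \<comment> \<open>The repair raises the sum by one, which pays for the flag whether or not it was
    already set. With the flag set, the clause about \<open>D\<close> is void.\<close>
  have changed: "progress n g E S (insert (b, a) D) (r', m')"
    if "violated g E h b a" "stores n g E (relax E h b a) m'"
      "r' 9 = 1" "r' 1 = 1" "r' 2 = n" "r' 3 = Suc (n * n)" "r' 4 = Suc (n * n + n)"
    for r' m'
    unfolding progress_def using that h below_valid_relax[OF h(2) that(1) n(2,1)] sum_relax[OF n(2,1), of E h]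
    by (auto intro!: exI[of _ "relax E h b a"])
  \<comment> \<open>These are the outcomes of the program's tests. Truncated subtraction is nonzero
    exactly for a strict inequality; for a non-arc, \<open>h b\<close> is increased first, so that
    the test becomes \<open>h a <= h b\<close>.\<close>
  consider "\<not> g a < g b" | "g a < g b" "E b a" "h b < h a" | "g a < g b" "E b a" "\<not> h b < h a"
    | "g a < g b" "\<not> E b a" "h a \<le> h b" | "g a < g b" "\<not> E b a" "\<not> h a \<le> h b"
    by blast
  then show ?thesis
  proof cases
    case 1
    then show ?thesis
      by (simp add: relax_prog_def r regs mem unchanged violated_def)
  next
    case 2
    have "stores n g E (relax E h b a) (m(Suc (n * n + n + b) := Suc (h b)))"
      using stores_fun_upd[OF h(1) n(2)] 2 by (simp add: relax_def)
    with 2 show ?thesis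
      by (simp add: relax_prog_def r regs mem changed violated_def)
  next
    case 3
    then show ?thesis
      by (simp add: relax_prog_def r regs mem unchanged violated_def)
  next
    case 4
    have "stores n g E (relax E h b a) (m(Suc (n * n + n + a) := Suc (h a)))"
      using stores_fun_upd[OF h(1) n(1)] 4 by (simp add: relax_def)
    with 4 show ?thesis
      by (simp add: relax_prog_def r regs mem changed violated_def Suc_diff_le)
  next
    case 5
    then show ?thesis
      by (simp add: relax_prog_def r regs mem unchanged violated_def)
  qed
qed

lemma progress_cong:
  assumes "progress n g E S D (r, m)" "\<And>x. x \<in> {1, 2, 3, 4, 9} \<Longrightarrow> r' x = r x"
  shows "progress n g E S D (r', m)"
  using assms by (auto simp: progress_def)

lemma wp_row_prog:
  assumes P: "progress n g E S ({Suc b..<n} \<times> {..<n}) (r, m)"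
    and r: "r 6 = Suc b" "r 7 = 1 + Suc b * n" and b: "b < n"
  shows "wp row_prog (r, m) (\<lambda>t (r', m'). t \<le> n * 26 + 6 \<and> progress n g E S ({b..<n} \<times> {..<n}) (r', m') \<and>
    r' 6 = b \<and> r' 7 = 1 + b * n \<and> r' 5 = r 5)"
proof -
  \<comment> \<open>Rows and columns are visited downwards: later rows are finished, and row
    \<open>b\<close> is finished from column \<open>k\<close> on.\<close>
  define D where "D k = {Suc b..<n} \<times> {..<n} \<union> {b} \<times> {k..<n}" for k
  define I where "I k = (\<lambda>(r', m'). progress n g E S (D k) (r', m') \<and> k \<le> n \<and> r' 8 = k \<and>
    r' 7 = 1 + b * n \<and> r' 6 = b \<and> r' 5 = r 5)" for k :: nat
  have D_Suc: "D k = insert (b, k) (D (Suc k))" if "k < n" for k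
    using that by (auto simp: D_def)
  have D_0: "D 0 = {b..<n} \<times> {..<n}"
    using b by (auto simp: D_def)
  have regs: "r (Suc 0) = 1" "r 2 = n"
    using P by (auto simp: progress_def)
  have init: "I n (r(6 := b, 7 := Suc (b * n), 8 := n), m)"
    using P by (auto simp: I_def D_def elim!: progress_cong)
  have loop: "wp (While 8 relax_prog) (r(6 := b, 7 := Suc (b * n), 8 := n), m)
    (\<lambda>t s'. t \<le> n * Suc 25 + 1 \<and> I 0 s')"
  proof (rule wp_While[where I = I, OF init])
    fix k r' m' assume I: "I (Suc k) (r', m')"
    show "wp relax_prog (r', m') (\<lambda>t s'. t \<le> 25 \<and> I k s')"
      by (rule wp_mono, rule wp_relax_prog[of n g E S "D (Suc k)" r' m' k b])
        (use I b in \<open>auto simp: I_def D_Suc[of k]\<close>)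
  qed (auto simp: I_def)
  show ?thesis
    unfolding row_prog_def using r regs
    by (simp, intro wp_mono[OF loop]) (auto simp: I_def D_0)
qed

text \<open>Resetting the flag moves its contribution into the guaranteed part, which becomes
  \<open>S + r 9\<close>.\<close>

lemma wp_sweep_prog:
  assumes P: "progress n g E S {} (r, m)" and r: "r 5 = Suc k"
  shows "wp sweep_prog (r, m) (\<lambda>t (r', m'). t \<le> n * (n * 26 + 7) + 6 \<and>
    progress n g E (S + r 9) ({..<n} \<times> {..<n}) (r', m') \<and> r' 5 = k)"
proof -
  define I where "I b = (\<lambda>(r', m'). progress n g E (S + r 9) ({b..<n} \<times> {..<n}) (r', m') \<and> b \<le> n \<and>
    r' 6 = b \<and> r' 7 = 1 + b * n \<and> r' 5 = k)" for b
  have regs: "r (Suc 0) = 1" "r 2 = n" "r 3 = Suc (n * n)"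
    using P by (auto simp: progress_def)
  have init: "I n (r(5 := k, 9 := 0, 6 := n, 7 := Suc (n * n)), m)"
    using P by (auto simp: I_def progress_def)
  have loop: "wp (While 6 row_prog) (r(5 := k, 9 := 0, 6 := n, 7 := Suc (n * n)), m)
    (\<lambda>t s'. t \<le> n * Suc (n * 26 + 6) + 1 \<and> I 0 s')"
  proof (rule wp_While[where I = I, OF init])
    fix b r' m' assume I: "I (Suc b) (r', m')"
    show "wp row_prog (r', m') (\<lambda>t s'. t \<le> n * 26 + 6 \<and> I b s')"
      by (rule wp_mono, rule wp_row_prog[of n g E "S + r 9" b r' m'])
        (use I in \<open>auto simp: I_def\<close>)
  qed (auto simp: I_def)
  show ?thesis
    unfolding sweep_prog_def using r regs
    by (simp, intro wp_mono[OF loop]) (auto simp: I_def atLeast0LessThan add.commute)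
qed

text \<open>The loop has no early exit, so a sweep without repairs must be shown to stay without
  repairs afterwards. A flag set at the end then means that every sweep made a repair.\<close>

lemma wp_sweeps:
  assumes P: "progress n g E 0 {} (r, m)" and r: "r 5 = Suc k" "r 9 = 0"
  shows "wp (While 5 sweep_prog) (r, m) (\<lambda>t (r', m'). t \<le> Suc k * (n * (n * 26 + 7) + 7) + 1 \<and>
    (r' 9 \<noteq> 0 \<longrightarrow> progress n g E k {} (r', m')) \<and>
    (r' 9 = 0 \<longrightarrow> progress n g E 0 ({..<n} \<times> {..<n}) (r', m')))"
proof -
  \<comment> \<open>The guaranteed sum is that of a solution \<open>f\<close>, while
    \<open>below_valid\<close> bounds the sum from above by the same number. No later repair is
    possible, as \<open>remains_settled\<close> shows.\<close>
  define settled where "settled = (\<lambda>(r', m'). r' 9 = 0 \<and>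
    (\<exists>f. valid n g E f \<and> progress n g E (sum f {..<n}) ({..<n} \<times> {..<n}) (r', m')))"
  \<comment> \<open>The state after \<open>j\<close> sweeps: unless settled, \<open>j - 1\<close>
    repairs are banked and the flag accounts for the last one. For \<open>j = 0\<close> the
    truncated difference is 0.\<close>
  define J where "J j = (\<lambda>(r', m'). settled (r', m') \<or>
    (progress n g E (j - 1) {} (r', m') \<and> (0 < j \<longrightarrow> 0 < r' 9)))" for j :: nat
  define I where "I i = (\<lambda>(r', m'). i \<le> Suc k \<and> r' 5 = i \<and> J (Suc k - i) (r', m'))" for i
  have settledI: "settled (r', m')" if "progress n g E S ({..<n} \<times> {..<n}) (r', m')" "r' 9 = 0" for S r' m'
    using that unfolding settled_def progress_def valid_def by fastforce
  have weaken: "progress n g E S {} (r', m')" if "progress n g E S' D (r', m')" "S \<le> S'" for S S' D r' m'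
    using that unfolding progress_def by fastforce
  have remains_settled: "r'' 9 = 0"
    if *: "valid n g E f" "progress n g E (sum f {..<n}) D (r'', m'')" for f D r'' m''
  proof -
    obtain h where h: "below_valid n g E h" "sum f {..<n} + r'' 9 \<le> sum h {..<n}"
      using *(2) by (auto simp: progress_def)
    have "sum h {..<n} \<le> sum f {..<n}"
      using h(1) *(1) by (intro sum_mono) (auto simp: below_valid_def)
    with h(2) show ?thesis by simp
  qed
  have step: "wp sweep_prog (r', m') (\<lambda>t s'. t \<le> n * (n * 26 + 7) + 6 \<and> I i s')" if I: "I (Suc i) (r', m')" for i r' m'
  proof -
    have i: "Suc i \<le> Suc k" "r' 5 = Suc i" and J: "J (Suc k - Suc i) (r', m')"
      using I by (auto simp: I_def)
    have Suc_k: "Suc k - i = Suc (Suc k - Suc i)"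
      using i by simp
    from J consider "settled (r', m')" | "progress n g E (Suc k - Suc i - 1) {} (r', m')" "0 < Suc k - Suc i \<longrightarrow> 0 < r' 9"
      by (auto simp: J_def)
    then show ?thesis
    proof cases
      case 1
      then obtain f where f: "valid n g E f" "r' 9 = 0" "progress n g E (sum f {..<n}) {} (r', m')"
        unfolding settled_def by (auto intro: weaken)
      show ?thesis
        by (rule wp_mono[OF wp_sweep_prog[OF f(3) i(2)]])
          (use f i settledI remains_settled in \<open>auto simp: I_def J_def\<close>)
    next
      case 2
      have le: "Suc k - Suc i \<le> Suc k - Suc i - 1 + r' 9"
        using 2(2) by linarith
      show ?thesis
      proof (rule wp_mono[OF wp_sweep_prog[OF 2(1) i(2)]])
        fix t r'' m''
        assume "case (r'', m'') of (r'', m'') \<Rightarrow> t \<le> n * (n * 26 + 7) + 6 \<and>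
          progress n g E (Suc k - Suc i - 1 + r' 9) ({..<n} \<times> {..<n}) (r'', m'') \<and> r'' 5 = i"
        then have *: "t \<le> n * (n * 26 + 7) + 6" "r'' 5 = i"
          and P: "progress n g E (Suc k - Suc i - 1 + r' 9) ({..<n} \<times> {..<n}) (r'', m'')"
          by simp_all
        have "J (Suc k - i) (r'', m'')"
          unfolding J_def Suc_k using settledI[OF P] weaken[OF P le] by auto
        then show "t \<le> n * (n * 26 + 7) + 6 \<and> I i (r'', m'')"
          using * i by (auto simp: I_def)
      qed
    qed
  qed
  have "I (Suc k) (r, m)"
    using P r by (auto simp: I_def J_def)
  then have "wp (While 5 sweep_prog) (r, m) (\<lambda>t s'. t \<le> Suc k * Suc (n * (n * 26 + 7) + 6) + 1 \<and> I 0 s')"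
  proof (rule wp_While)
    show "wp sweep_prog (r', m') (\<lambda>t s'. t \<le> n * (n * 26 + 7) + 6 \<and> I i s')" if "I (Suc i) (r', m')" for i r' m'
      using that by (rule step)
  qed (auto simp: I_def)
  then show ?thesis
  proof (rule wp_mono)
    fix t r' m'
    assume t: "t \<le> Suc k * Suc (n * (n * 26 + 7) + 6) + 1 \<and> I 0 (r', m')"
    then have "J (Suc k) (r', m')"
      by (auto simp: I_def)
    then have "(r' 9 \<noteq> 0 \<longrightarrow> progress n g E k {} (r', m')) \<and>
       (r' 9 = 0 \<longrightarrow> progress n g E 0 ({..<n} \<times> {..<n}) (r', m'))"
      by (auto simp: J_def settled_def progress_def)
    with t show "case (r', m') of (r', m') \<Rightarrow> t \<le> Suc k * (n * (n * 26 + 7) + 7) + 1 \<and>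
       (r' 9 \<noteq> 0 \<longrightarrow> progress n g E k {} (r', m')) \<and>
       (r' 9 = 0 \<longrightarrow> progress n g E 0 ({..<n} \<times> {..<n}) (r', m'))"
      by (simp add: add.commute)
  qed
qed

section \<open>Writing the output\<close>

lemma wp_write:
  assumes st: "stores n g E h m" and g: "bij_betw g {..<n} {1..n}"
    and r: "r (Suc 0) = 1" "r 2 = n" "r 3 = Suc (n * n)" "r 4 = Suc (n * n + n)" "r 8 = n"
  shows "wp (While 8 write_prog) (r, m)
    (\<lambda>t (r', m'). t \<le> n * 9 + 1 \<and> (\<forall>a<n. m' (g a) = Suc (h a)) \<and> r' (Suc 0) = 1 \<and> r' 2 = n)"
proof -
  define I where "I k = (\<lambda>(r', m'). k \<le> n \<and> r' 8 = k \<and> r' (Suc 0) = 1 \<and> r' 2 = n \<and>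
    r' 3 = Suc (n * n) \<and> r' 4 = Suc (n * n + n) \<and>
    (\<forall>a<n. m' (Suc (n * n + a)) = g a) \<and> (\<forall>a<n. m' (Suc (n * n + n + a)) = h a) \<and>
    (\<forall>a\<in>{k..<n}. m' (g a) = Suc (h a)))" for k :: nat
  have g_le: "g a \<le> n * n" if "a < n" for a
  proof -
    have "g a \<le> n" using bij_betwE[OF g] that by auto
    also have "n \<le> n * n" by simp
    finally show ?thesis .
  qed
  have g_neq: "g a \<noteq> Suc (n * n + c)" if "a < n" for a c
    using g_le[OF that] by simp
  have g_eq: "g a = g b \<longleftrightarrow> a = b" if "a < n" "b < n" for a b
    using g that by (auto simp: bij_betw_def inj_on_def)
  have "I n (r, m)"
    using st r by (auto simp: I_def stores_def)
  then have "wp (While 8 write_prog) (r, m) (\<lambda>t s'. t \<le> n * Suc 8 + 1 \<and> I 0 s')"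
  proof (rule wp_While)
    fix k r' m' assume I: "I (Suc k) (r', m')"
    then show "wp write_prog (r', m') (\<lambda>t s'. t \<le> 8 \<and> I k s')"
      using g_neq[of k] g_neq[of k, THEN not_sym] g_eq
      by (auto simp: I_def write_prog_def add.assoc)
  qed (auto simp: I_def)
  then show ?thesis
    by (rule wp_mono) (auto simp: I_def)
qed

text \<open>Cell 0 holds the success bit, so the 1-based position \<open>g a\<close> in the sequence
  is also its list index in \<open>out\<close>. \<open>Suc\<close> moves the values from base 0 to
  the alphabet starting at 1.\<close>

definition solution_output :: "nat \<Rightarrow> (nat \<Rightarrow> nat) \<Rightarrow> (nat \<Rightarrow> nat) \<Rightarrow> nat list \<Rightarrow> bool" where
  "solution_output n g h out \<longleftrightarrow>
     length out = Suc n \<and> out ! 0 = 1 \<and> (\<forall>a<n. out ! g a = Suc (h a))"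

definition correct_output :: "nat \<Rightarrow> (nat \<Rightarrow> nat) \<Rightarrow> (nat \<Rightarrow> nat \<Rightarrow> bool) \<Rightarrow> nat list \<Rightarrow> bool" where
  "correct_output n g E out \<longleftrightarrow>
     (\<exists>h. valid n g E h \<and> below_valid n g E h \<and> solution_output n g h out) \<or>
     (\<nexists>f. valid n g E f) \<and> out = [0]"

lemma wp_output_prog:
  assumes g: "bij_betw g {..<n} {1..n}"
    and changed: "r 9 \<noteq> 0 \<Longrightarrow> progress n g E (n * n + n) {} (r, m)"
    and unchanged: "r 9 = 0 \<Longrightarrow> progress n g E 0 ({..<n} \<times> {..<n}) (r, m)"
  shows "wp output_prog (r, m) (\<lambda>t s. t \<le> n * 9 + 12 \<and> correct_output n g E (output_of s))"
proof (cases "r 9 = 0")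
  case False
  \<comment> \<open>The guaranteed sum is \<open>n * n + n\<close>, and the nonzero flag adds at
    least one, which makes the inequality strict.\<close>
  then obtain h where "below_valid n g E h" "n * n < sum h {..<n}"
    using changed by (auto simp: progress_def)
  then have "\<nexists>f. valid n g E f"
    using not_valid_if_large_sum by blast
  then show ?thesis
    using False by (simp add: output_prog_def correct_output_def output_of_def)
next
  case True
  then obtain h where h: "stores n g E h m" "below_valid n g E h" "valid n g E h"
    and regs: "r (Suc 0) = 1" "r 2 = n" "r 3 = Suc (n * n)" "r 4 = Suc (n * n + n)"
    using unchanged by (auto simp: progress_def valid_def)
  have g_bounds: "0 < g a" "g a < Suc n" if "a < n" for a
    using bij_betwE[OF g] that by (auto simp: Suc_le_eq less_Suc_eq_le)
  have out: "correct_output n g E (output_of (r'(10 := 0, 0 := Suc n), m'(0 := Suc 0)))"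
    if "\<forall>a<n. m' (g a) = Suc (h a)" for r' m'
  proof -
    have "solution_output n g h (output_of (r'(10 := 0, 0 := Suc n), m'(0 := Suc 0)))"
      using that g_bounds by (fastforce simp: solution_output_def output_of_def nth_append simp del: upt_Suc)
    with h(2,3) show ?thesis
      unfolding correct_output_def by blast
  qed
  have loop: "wp (While 8 write_prog) (r(10 := 0, 8 := n), m) (\<lambda>t (r', m'). t \<le> n * 9 + 1 \<and>
      (\<forall>a<n. m' (g a) = Suc (h a)) \<and> r' (Suc 0) = 1 \<and> r' 2 = n)"
    by (rule wp_write[OF h(1) g]) (simp_all add: regs)
  show ?thesis
    by (simp add: output_prog_def True regs, intro wp_mono[OF loop]) (simp add: out)
qed

text \<open>Multiplication is avoided because the input length is already
  \<open>n * n + n + 1\<close>: subtracting \<open>n\<close> gives the address of the ordering, and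
  the length itself is both the address of the tentative sequence and a sufficient number of
  sweeps.\<close>

lemma wp_alphabet_prog:
  assumes st: "stores n g E (\<lambda>_. 0) m" and g: "bij_betw g {..<n} {1..n}"
    and r: "r 0 = Suc (n * n + n)" "r 9 = 0"
  shows "wp alphabet_prog (r, m)
    (\<lambda>t s. t \<le> 26 * (r 0 * r 0) + 9 * r 0 + 30 \<and> correct_output n g E (output_of s))"
proof -
  define r0 where "r0 = r(1 := 1, 10 := 0, 2 := n, 3 := Suc (n * n), 4 := Suc (n * n + n), 5 := Suc (n * n + n))"
  define T where "T = 26 * (r 0 * r 0) + 9 * r 0 + 30"
  have m0: "m 0 = n"
    using st by (simp add: stores_def)
  have "progress n g E 0 {} (r0, m)"
    using st r by (auto simp: progress_def r0_def below_valid_def)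
  then have sweeps: "wp (While 5 sweep_prog) (r0, m)
    (\<lambda>t (r', m'). t \<le> r 0 * (n * (n * 26 + 7) + 7) + 1 \<and>
      (r' 9 \<noteq> 0 \<longrightarrow> progress n g E (n * n + n) {} (r', m')) \<and>
      (r' 9 = 0 \<longrightarrow> progress n g E 0 ({..<n} \<times> {..<n}) (r', m')))"
    using wp_sweeps[of n g E r0 m "n * n + n"] r by (simp add: r0_def)
  have T: "r 0 * (n * (n * 26 + 7) + 7) + n * 9 + 30 \<le> T"
  proof -
    \<comment> \<open>A sweep is linear in the input length, and there are as many sweeps as the
      input is long; hence the quadratic bound.\<close>
    have "n * (n * 26 + 7) + 7 \<le> 26 * r 0"
      by (simp add: r algebra_simps)
    then have "r 0 * (n * (n * 26 + 7) + 7) \<le> r 0 * (26 * r 0)"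
      by (rule mult_le_mono2)
    moreover have "n \<le> r 0"
      using r by simp
    ultimately show ?thesis
      unfolding T_def by linarith
  qed
  have rest: "wp output_prog (r', m') (\<lambda>t' s. Suc (Suc (Suc (Suc (Suc (Suc (Suc (t + t'))))))) \<le> T \<and>
      correct_output n g E (output_of s))"
    if "case (r', m') of (r', m') \<Rightarrow> t \<le> r 0 * (n * (n * 26 + 7) + 7) + 1 \<and>
      (r' 9 \<noteq> 0 \<longrightarrow> progress n g E (n * n + n) {} (r', m')) \<and>
      (r' 9 = 0 \<longrightarrow> progress n g E 0 ({..<n} \<times> {..<n}) (r', m'))" for t r' m'
  proof (rule wp_mono[OF wp_output_prog[OF g]])
    fix t' r'' m''
    assume "t' \<le> n * 9 + 12 \<and> correct_output n g E (output_of (r'', m''))"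
    then show "Suc (Suc (Suc (Suc (Suc (Suc (Suc (t + t'))))))) \<le> T \<and> correct_output n g E (output_of (r'', m''))"
      using T that by simp
  qed (use that in auto)
  have r0: "r(Suc 0 := Suc 0, 10 := 0, 2 := n, 3 := Suc (n * n), 4 := Suc (n * n + n), 5 := Suc (n * n + n)) = r0"
    by (simp add: r0_def)
  show ?thesis
    unfolding T_def[symmetric]
    by (simp add: alphabet_prog_def m0 r(1) r0, rule wp_mono[OF sweeps], drule rest, simp)
qed

section \<open>Representing sequences as solutions of the constraints\<close>

lemma valid_cong: "(\<And>a. a < n \<Longrightarrow> h a = h' a) \<Longrightarrow> valid n g E h \<longleftrightarrow> valid n g E h'"
  by (auto simp: valid_def violated_def)

lemma valid_Suc: "valid n g E (\<lambda>a. Suc (h a)) \<longleftrightarrow> valid n g E h"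
  by (simp add: valid_def violated_def)

text \<open>Vertex indices run through all positions via the ordering. For positions in increasing
  order, the equivalence with adjacency is exactly one difference constraint; for all other pairs
  both sides are false, because arcs decrease the ordering.\<close>

lemma represents_iff_valid:
  assumes top: "topological_ordering G \<gamma>" and vs: "distinct vs" "set vs = pverts G"
  shows "represents G \<gamma> k \<tau> \<longleftrightarrow> length \<tau> = length vs \<and> set \<tau> \<subseteq> {1..k} \<and>
    valid (length vs) (\<lambda>a. \<gamma> (vs ! a)) (\<lambda>b a. (vs ! b, vs ! a) \<in> parcs G) (\<lambda>a. \<tau> ! (\<gamma> (vs ! a) - 1))"
proof -
  have card: "card (pverts G) = length vs"
    using vs distinct_card by metis
  have inj: "inj_on \<gamma> (pverts G)" and im: "\<gamma> ` pverts G = {1..length vs}"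
    using top card by (auto simp: topological_ordering_def bij_betw_def)
  have mem: "vs ! a \<in> pverts G" if "a < length vs" for a
    using that vs(2) nth_mem by blast
  have inv: "inv_into (pverts G) \<gamma> (\<gamma> (vs ! a)) = vs ! a" if "a < length vs" for a
    using inj mem[OF that] by simp
  have range: "{1..length vs} = (\<lambda>a. \<gamma> (vs ! a)) ` {..<length vs}"
    unfolding im[symmetric] vs(2)[symmetric] by (auto simp: set_conv_nth)
  have arc: "\<gamma> u < \<gamma> v" if "(v, u) \<in> parcs G" for v u
    using top that by (auto simp: topological_ordering_def)
  have bounds: "\<gamma> (vs ! a) \<in> {1..length vs}" if "a < length vs" for a
    using that range by blast
  have "(\<forall>i\<in>{1..length vs}. \<forall>j\<in>{1..length vs}.
      (j, i) \<in> parcs (PermDAG \<tau>) \<longleftrightarrow> (inv_into (pverts G) \<gamma> j, inv_into (pverts G) \<gamma> i) \<in> parcs G) \<longleftrightarrow>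
    valid (length vs) (\<lambda>a. \<gamma> (vs ! a)) (\<lambda>b a. (vs ! b, vs ! a) \<in> parcs G) (\<lambda>a. \<tau> ! (\<gamma> (vs ! a) - 1))"
    (is "?L \<longleftrightarrow> ?R") if len: "length \<tau> = length vs"
  proof -
    have "?L \<longleftrightarrow> (\<forall>a<length vs. \<forall>b<length vs.
      (\<gamma> (vs ! b), \<gamma> (vs ! a)) \<in> parcs (PermDAG \<tau>) \<longleftrightarrow> (vs ! b, vs ! a) \<in> parcs G)"
      unfolding range by (auto simp: inv)
    also have "\<dots> \<longleftrightarrow> (\<forall>a<length vs. \<forall>b<length vs.
      (\<gamma> (vs ! a) < \<gamma> (vs ! b) \<and> \<tau> ! (\<gamma> (vs ! a) - 1) \<le> \<tau> ! (\<gamma> (vs ! b) - 1))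
        \<longleftrightarrow> (vs ! b, vs ! a) \<in> parcs G)"
      using bounds len by (auto simp: PermDAG_def)
    also have "\<dots> \<longleftrightarrow> ?R"
      unfolding valid_def violated_def using arc by (smt (verit) leD leI)
    finally show ?thesis .
  qed
  then show ?thesis
    unfolding represents_def Let_def card by blast
qed

section \<open>Attainment and finiteness of the alphabet size\<close>

lemma alphabet_size_attained:
  assumes "represents G \<gamma> k \<tau>"
  obtains k' \<tau>' where "alphabet_size G \<gamma> = enat k'" "represents G \<gamma> k' \<tau>'"
proof -
  let ?A = "{enat k | k. \<exists>\<tau>. represents G \<gamma> k \<tau>}"
  have "enat k \<in> ?A" using assms by blast
  then have "Inf ?A \<in> ?A"
    unfolding Inf_enat_def by (metis (mono_tags, lifting) LeastI empty_iff)
  then show ?thesis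
    using that unfolding alphabet_size_def by blast
qed

lemma alphabet_size_less_infinity_iff:
  "alphabet_size G \<gamma> < \<infinity> \<longleftrightarrow> (\<exists>k \<tau>. represents G \<gamma> k \<tau>)"
proof (cases "\<exists>k \<tau>. represents G \<gamma> k \<tau>")
  case True
  then show ?thesis
    by (metis alphabet_size_attained enat_ord_code(4))
next
  case False
  then show ?thesis
    by (simp add: alphabet_size_def Inf_enat_def)
qed

section \<open>Memory layout of an encoded instance\<close>

lemma length_concat_map_map:
  "length (concat (map (\<lambda>x. map (f x) ys) xs)) = length xs * length ys"
  by (induction xs) auto

lemma nth_concat_map_map:
  "b < length xs \<Longrightarrow> a < length ys \<Longrightarrow>
    concat (map (\<lambda>x. map (f x) ys) xs) ! (b * length ys + a) = f (xs ! b) (ys ! a)"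
proof (induction xs arbitrary: b)
  case (Cons x xs)
  then show ?case
    by (cases b) (auto simp: nth_append)
qed simp

lemma length_encode_instance:
  "length (encode_instance vs G \<gamma>) = Suc (length vs * length vs + length vs)"
  by (simp add: encode_instance_def length_concat_map_map)

text \<open>The cells behind the input are initially zero, so the zero sequence needs no
  initialisation.\<close>

lemma stores_encode_instance:
  "stores (length vs) (\<lambda>a. \<gamma> (vs ! a)) (\<lambda>b a. (vs ! b, vs ! a) \<in> parcs G) (\<lambda>_. 0)
     (snd (initial_state (encode_instance vs G \<gamma>)))"
proof -
  let ?n = "length vs"
  have "encode_instance vs G \<gamma> ! Suc (b * ?n + a) = of_bool ((vs ! b, vs ! a) \<in> parcs G)"
    if "b < ?n" "a < ?n" for a b
    using mult_add_less_square[OF that] that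
    by (simp add: encode_instance_def nth_append length_concat_map_map nth_concat_map_map)
  moreover have "encode_instance vs G \<gamma> ! Suc (?n * ?n + a) = \<gamma> (vs ! a)" if "a < ?n" for a
    using that by (simp add: encode_instance_def nth_append length_concat_map_map)
  moreover have "encode_instance vs G \<gamma> ! 0 = ?n"
    by (simp add: encode_instance_def)
  moreover have "b * ?n + a < ?n * ?n + ?n" if "b < ?n" "a < ?n" for a b
    using mult_add_less_square[OF that] by simp
  ultimately show ?thesis
    by (simp add: stores_def initial_state_def length_encode_instance)
qed

theorem theorem2:
  shows "\<exists>(alg :: ram_prog) (b :: nat poly).
    \<forall>(G :: nat pair_pre_digraph) (\<gamma> :: nat \<Rightarrow> nat) (vs :: nat list).
      permutation_DAG G \<and> topological_ordering G \<gamma> \<and> distinct vs \<and> set vs = pverts G \<longrightarrow>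
      (\<exists>t out. computes_in alg (encode_instance vs G \<gamma>) t out \<and>
        t \<le> poly b (length (encode_instance vs G \<gamma>)) \<and>
        (if alphabet_size G \<gamma> < \<infinity>
         then \<exists>\<tau>. out = 1 # \<tau> \<and> achieves_alphabet_size G \<gamma> \<tau>
         else out = [0]))"
proof (intro exI[of _ alphabet_prog] exI[of _ "[:30, 9, 26:] :: nat poly"] allI impI, elim conjE)
  fix G :: "nat pair_pre_digraph" and \<gamma> :: "nat \<Rightarrow> nat" and vs :: "nat list"
  assume top: "topological_ordering G \<gamma>" and vs: "distinct vs" "set vs = pverts G"
  define n where "n = length vs"
  define g where "g = (\<lambda>a. \<gamma> (vs ! a))"
  define E where "E = (\<lambda>b a. (vs ! b, vs ! a) \<in> parcs G)"
  define N where "N = length (encode_instance vs G \<gamma>)"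
  have rep: "represents G \<gamma> k \<tau> \<longleftrightarrow> length \<tau> = n \<and> set \<tau> \<subseteq> {1..k} \<and> valid n g E (\<lambda>a. \<tau> ! (g a - 1))" for k \<tau>
    using represents_iff_valid[OF top vs] by (simp add: n_def g_def E_def)
  have g: "bij_betw g {..<n} {1..n}"
  proof -
    have "bij_betw (\<lambda>a. vs ! a) {..<n} (pverts G)"
      using vs by (intro bij_betw_nth) (auto simp: n_def)
    moreover have "bij_betw \<gamma> (pverts G) {1..n}"
      using top vs distinct_card[of vs] by (simp add: topological_ordering_def n_def)
    ultimately show ?thesis
      using bij_betw_trans by (fastforce simp: g_def comp_def)
  qed
  have g_bounds: "g a \<in> {1..n}" if "a < n" for a
    using bij_betwE[OF g] that by auto
  \<comment> \<open>Entries of a representing sequence are at least 1, so the outer truncated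
    subtraction is exact and shifts the solution to base 0.\<close>
  have sol: "valid n g E (\<lambda>a. \<tau> ! (g a - 1) - 1)" if "represents G \<gamma> k \<tau>" for k \<tau>
  proof -
    have "valid n g E (\<lambda>a. Suc (\<tau> ! (g a - 1) - 1)) \<longleftrightarrow> valid n g E (\<lambda>a. \<tau> ! (g a - 1))"
    proof (rule valid_cong)
      fix a assume "a < n"
      then have "\<tau> ! (g a - 1) \<in> set \<tau>"
        using that g_bounds[of a] by (intro nth_mem) (auto simp: rep)
      then show "Suc (\<tau> ! (g a - 1) - 1) = \<tau> ! (g a - 1)"
        using that by (auto simp: rep)
    qed
    then show ?thesis
      using that by (simp add: rep valid_Suc)
  qed
  obtain r m where rm: "initial_state (encode_instance vs G \<gamma>) = (r, m)"
    by fastforce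
  have st: "stores n g E (\<lambda>_. 0) m"
    using stores_encode_instance[of vs \<gamma> G] rm by (simp add: n_def g_def E_def)
  have r: "r 0 = N" "r 9 = 0" "N = Suc (n * n + n)"
    using rm by (auto simp: initial_state_def N_def n_def length_encode_instance)
  obtain t s where ex: "exec alphabet_prog (r, m) t s" "t \<le> 26 * (N * N) + 9 * N + 30"
    and s: "correct_output n g E (output_of s)"
    using wp_alphabet_prog[OF st g] r unfolding wp_def by metis
  have "if alphabet_size G \<gamma> < \<infinity> then \<exists>\<tau>. output_of s = 1 # \<tau> \<and> achieves_alphabet_size G \<gamma> \<tau>
    else output_of s = [0]"
    using s unfolding correct_output_def
  proof (elim disjE exE conjE)
    fix h assume h: "valid n g E h" "below_valid n g E h" "solution_output n g h (output_of s)"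
    then obtain \<tau> where \<tau>: "output_of s = 1 # \<tau>" "length \<tau> = n"
      by (cases "output_of s") (auto simp: solution_output_def)
    have \<tau>_nth: "\<tau> ! (g a - 1) = Suc (h a)" if "a < n" for a
      using h(3) g_bounds[OF that] that unfolding \<tau> solution_output_def by (auto simp: nth_Cons')
    have \<tau>_valid: "valid n g E (\<lambda>a. \<tau> ! (g a - 1))"
      using h(1) valid_cong[OF \<tau>_nth] by (simp add: valid_Suc)
    have set_\<tau>: "\<exists>a<n. x = Suc (h a) \<and> g a - 1 < n" if x: "x \<in> set \<tau>" for x
    proof -
      obtain i where i: "i < n" "x = \<tau> ! i"
        using x \<tau>(2) by (auto simp: in_set_conv_nth)
      then have "Suc i \<in> g ` {..<n}"
        using g by (auto simp: bij_betw_def)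
      then obtain a where "a < n" "g a = Suc i"
        by auto
      then show ?thesis
        using \<tau>_nth[of a] i by auto
    qed
    \<comment> \<open>Any sufficiently large alphabet shows finiteness here; inserting 0 covers the
      empty sequence.\<close>
    have "represents G \<gamma> (Max (insert 0 (set \<tau>))) \<tau>"
      using \<tau>_valid \<tau>(2) set_\<tau> by (fastforce simp: rep)
    then obtain k \<sigma> where k: "alphabet_size G \<gamma> = enat k" "represents G \<gamma> k \<sigma>"
      by (rule alphabet_size_attained)
    \<comment> \<open>Optimality: an optimal \<open>\<sigma>\<close>, shifted to base 0, is a
      solution and so lies above \<open>h\<close>. Hence each entry of \<open>\<tau>\<close> is at
      most the corresponding entry of \<open>\<sigma>\<close>, which is at most
      \<open>k\<close>.\<close>
    have "set \<tau> \<subseteq> {1..k}"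
    proof
      fix x assume "x \<in> set \<tau>"
      then obtain a where a: "a < n" "x = Suc (h a)" "g a - 1 < n"
        using set_\<tau> by blast
      then have "\<sigma> ! (g a - 1) \<in> {1..k}"
        using k(2) by (metis rep nth_mem subsetD)
      moreover have "h a \<le> \<sigma> ! (g a - 1) - 1"
        using h(2) sol[OF k(2)] a(1) by (auto simp: below_valid_def)
      ultimately show "x \<in> {1..k}"
        using a(2) by auto
    qed
    then have "achieves_alphabet_size G \<gamma> \<tau>"
      using k(1) \<tau>_valid \<tau>(2) by (auto simp: achieves_alphabet_size_def rep)
    then show ?thesis
      using k(1) \<tau>(1) by simp
  next
    \<comment> \<open>By \<open>sol\<close>, a representing sequence would yield a solution, so none
      exists and the alphabet size is infinite.\<close>
    assume "\<nexists>f. valid n g E f" "output_of s = [0]"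
    then show ?thesis
      using sol alphabet_size_less_infinity_iff[of G \<gamma>] by presburger
  qed
  moreover have "computes_in alphabet_prog (encode_instance vs G \<gamma>) t (output_of s)"
    using ex(1) rm unfolding computes_in_def by metis
  moreover have "t \<le> poly [:30, 9, 26:] (length (encode_instance vs G \<gamma>))"
    using ex(2) unfolding N_def[symmetric] by (simp add: algebra_simps)
  ultimately show "\<exists>t out. computes_in alphabet_prog (encode_instance vs G \<gamma>) t out \<and>
      t \<le> poly [:30, 9, 26:] (length (encode_instance vs G \<gamma>)) \<and>
      (if alphabet_size G \<gamma> < \<infinity> then \<exists>\<tau>. out = 1 # \<tau> \<and> achieves_alphabet_size G \<gamma> \<tau> else out = [0])"
    by blast
qed

end
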